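(* Suppose that $A_0$ and $A_1$ are jointly negative definite, that is, there exists $\mu_1\in\mathbb{R}$ such that $A_0+\mu_1A_1\prec 0$. Then the problem (GTR) has at most one local-nonglobal minimizer.
   Context: Let $A_0,A_1$ be real symmetric $n\times n$ matrices, $b_0,b_1\in\mathbb{R}^n$, $c_1\in\mathbb{R}$, $f_0(x)=x^TA_0x+2b_0^Tx$, $f_1(x)=x^TA_1x+2b_1^Tx+c_1$. Problem (GTR) is: minimize $f_0(x)$ over $x\in\mathbb{R}^n$ subject to $f_1(x)\le 0$. A local-nonglobal minimizer is a feasible point that is a local minimizer but not a global minimizer (a global minimizer being a feasible point whose objective value is at most that of every feasible point). *)

theory Defs
  imports "HOL-Analysis.Analysis"
begin

definition symmetric_matrix :: "real ^ 'n ^ 'n \<Rightarrow> bool" where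
  "symmetric_matrix A \<longleftrightarrow> transpose A = A"

text \<open>Only the sign condition on the quadratic form; symmetry is a separate hypothesis.\<close>

definition negative_definite :: "real ^ 'n ^ 'n \<Rightarrow> bool" where
  "negative_definite A \<longleftrightarrow> (\<forall>x. x \<noteq> 0 \<longrightarrow> x \<bullet> (A *v x) < 0)"

definition quad_fun :: "real ^ 'n ^ 'n \<Rightarrow> real ^ 'n \<Rightarrow> real \<Rightarrow> real ^ 'n \<Rightarrow> real" where
  "quad_fun A b c x = x \<bullet> (A *v x) + 2 * (b \<bullet> x) + c"

text \<open>In the following, \<open>f\<close> is minimized over the feasible set \<open>S\<close>.\<close>

definition global_minimizer :: "('a \<Rightarrow> real) \<Rightarrow> 'a set \<Rightarrow> 'a \<Rightarrow> bool" where
  "global_minimizer f S x \<longleftrightarrow> x \<in> S \<and> (\<forall>y\<in>S. f x \<le> f y)"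

definition local_minimizer :: "('a::metric_space \<Rightarrow> real) \<Rightarrow> 'a set \<Rightarrow> 'a \<Rightarrow> bool" where
  "local_minimizer f S x \<longleftrightarrow> x \<in> S \<and> (\<exists>\<epsilon>>0. \<forall>y \<in> S \<inter> ball x \<epsilon>. f x \<le> f y)"

definition local_nonglobal_minimizer :: "('a::metric_space \<Rightarrow> real) \<Rightarrow> 'a set \<Rightarrow> 'a \<Rightarrow> bool" where
  "local_nonglobal_minimizer f S x \<longleftrightarrow> local_minimizer f S x \<and> \<not> global_minimizer f S x"

end

theory Submission
  imports Defs
begin

text \<open>
  Write \<open>P c = A\<^sub>0 + c *\<^sub>R A\<^sub>1\<close> for the Hessian (up to a factor 2) of the Lagrangian \<open>f\<^sub>0 + c * f\<^sub>1\<close>.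

  A local-nonglobal minimizer \<open>x\<close> lies on the boundary \<open>f\<^sub>1 x = 0\<close>, the constraint is regular there,
  and some multiplier \<open>\<alpha> \<ge> 0\<close> makes the Lagrangian stationary at \<open>x\<close>, with \<open>P \<alpha>\<close> nonnegative on the
  tangent hyperplane \<open>g\<^sub>x\<^sup>\<bottom>\<close>, where \<open>g\<^sub>x = A\<^sub>1 *v x + b\<^sub>1\<close>.  All this comes from comparing \<open>f\<^sub>0\<close> along
  parabolic arcs \<open>x + \<tau> *\<^sub>R v + \<tau>\<^sup>2 *\<^sub>R w\<close>, along which quadratic functions are polynomials in \<open>\<tau>\<close>.
  Moreover \<open>P \<alpha>\<close> takes a negative value, since otherwise the Lagrangian would be convex and \<open>x\<close>
  a global minimizer.  These conditions are collected in \<open>saddle_critical\<close>, and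
  \<open>local_nonglobal_minimizer_saddle_critical\<close> derives them.

  Let \<open>x\<close>, \<open>y\<close> be two such points with multipliers \<open>\<alpha>\<close>, \<open>\<beta>\<close>, and let \<open>d = y - x\<close>.  Subtracting the
  stationarity equations gives \<open>P \<alpha> d = (\<alpha> - \<beta>) g\<^sub>y\<close> and \<open>P \<beta> d = (\<alpha> - \<beta>) g\<^sub>x\<close>, and comparing values
  of the Lagrangians gives \<open>d \<bullet> P \<alpha> d = f\<^sub>0 y - f\<^sub>0 x = - (d \<bullet> P \<beta> d)\<close>.

  Suppose \<open>f\<^sub>0 x < f\<^sub>0 y\<close> (\<open>saddle_critical_not_less\<close>).  Then \<open>\<alpha> \<noteq> \<beta>\<close>, so the
  \<open>P \<alpha>\<close>-orthogonal complement of \<open>d\<close> is exactly the tangent hyperplane at \<open>y\<close>.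
  As \<open>P \<alpha>\<close> is positive at \<open>d\<close> but negative somewhere, it is negative at some \<open>v\<close> in this hyperplane, where \<open>P \<beta>\<close> is nonnegative.  Now let \<open>P \<nu>\<close> be negative definite and
  write \<open>P \<alpha> = s A\<^sub>1 - D\<close>, \<open>P \<beta> = t A\<^sub>1 - D\<close> with \<open>D = - P \<nu>\<close> positive definite.  The signs at \<open>d\<close>
  and at \<open>v\<close> force \<open>s\<close> and \<open>t\<close> to have opposite signs.  Then \<open>P \<beta>\<close> is negative definite on \<open>g\<^sub>x\<^sup>\<bottom>\<close>, because
  \<open>s A\<^sub>1 \<ge> D\<close> there; it is also negative at \<open>d\<close>, which is \<open>P \<beta>\<close>-orthogonal to \<open>g\<^sub>x\<^sup>\<bottom>\<close>.  So \<open>P \<beta>\<close> is negative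
  definite, which contradicts its value at \<open>v\<close>.

  Suppose \<open>f\<^sub>0 x = f\<^sub>0 y\<close> and \<open>x \<noteq> y\<close> (\<open>saddle_critical_equal_value_unique\<close>).
  Then \<open>s (d \<bullet> A\<^sub>1 d) = d \<bullet> D d = t (d \<bullet> A\<^sub>1 d)\<close> with \<open>d \<bullet> D d > 0\<close>, hence
  \<open>\<alpha> = \<beta>\<close> and \<open>P \<alpha> d = 0\<close>.  The line through \<open>x\<close> and \<open>y\<close> is transversal to \<open>g\<^sub>x\<^sup>\<bottom>\<close>, so \<open>P \<alpha>\<close> is
  nonnegative everywhere, against the existence of a negative direction.
\<close>

section \<open>Quadratic functions and forms\<close>

lemma symmetric_matrix_inner_commute:
  fixes A :: "real ^ 'n ^ 'n"
  assumes "symmetric_matrix A"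
  shows "v \<bullet> (A *v w) = w \<bullet> (A *v v)"
  using assms unfolding symmetric_matrix_def
  by (metis dot_lmul_matrix inner_commute transpose_matrix_vector)

lemma symmetric_matrix_pencil:
  fixes A B :: "real ^ 'n ^ 'n"
  assumes "symmetric_matrix A" "symmetric_matrix B"
  shows "symmetric_matrix (A + c *\<^sub>R B)"
  using assms unfolding symmetric_matrix_def
  by (simp add: transpose_def vec_eq_iff)

lemma pencil_mult_vec:
  fixes A B :: "real ^ 'n ^ 'n"
  shows "(A + c *\<^sub>R B) *v v = A *v v + c *\<^sub>R (B *v v)"
  by (simp add: matrix_vector_mult_add_rdistrib scaleR_matrix_vector_assoc)

lemma form_add_scaleR:
  fixes P :: "real ^ 'n ^ 'n"
  assumes "symmetric_matrix P"
  shows "(u + k *\<^sub>R d) \<bullet> (P *v (u + k *\<^sub>R d)) =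
    u \<bullet> (P *v u) + 2 * k * (u \<bullet> (P *v d)) + k\<^sup>2 * (d \<bullet> (P *v d))"
  using symmetric_matrix_inner_commute[OF assms, of d u]
  by (simp add: matrix_vector_right_distrib matrix_vector_mult_scaleR inner_add_left
      inner_add_right power2_eq_square algebra_simps)

lemma quad_fun_add:
  fixes A :: "real ^ 'n ^ 'n"
  assumes "symmetric_matrix A"
  shows "quad_fun A b c (x + v) =
    quad_fun A b c x + 2 * ((A *v x + b) \<bullet> v) + v \<bullet> (A *v v)"
  using symmetric_matrix_inner_commute[OF assms, of v x]
  by (simp add: quad_fun_def matrix_vector_right_distrib inner_add_left inner_add_right
      inner_commute algebra_simps)

lemma hyperplane_decomposition:
  fixes g d z :: "'a::real_inner"
  assumes "g \<bullet> d \<noteq> 0"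
  obtains e k where "z = e + k *\<^sub>R d" "g \<bullet> e = 0"
proof
  show "z = (z - (g \<bullet> z / (g \<bullet> d)) *\<^sub>R d) + (g \<bullet> z / (g \<bullet> d)) *\<^sub>R d" by simp
  show "g \<bullet> (z - (g \<bullet> z / (g \<bullet> d)) *\<^sub>R d) = 0"
    using assms by (simp add: inner_diff_right)
qed

section \<open>Necessary conditions at a local-nonglobal minimizer\<close>

lemma quad_fun_arc:
  fixes A :: "real ^ 'n ^ 'n"
  assumes "symmetric_matrix A"
  shows "quad_fun A b c (x + (\<tau> *\<^sub>R v + \<tau>\<^sup>2 *\<^sub>R w)) - quad_fun A b c x =
    \<tau> * (2 * ((A *v x + b) \<bullet> v) + \<tau> * ((2 * ((A *v x + b) \<bullet> w) + v \<bullet> (A *v v))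
      + \<tau> * (2 * (v \<bullet> (A *v w)) + \<tau> * (w \<bullet> (A *v w)))))"
proof -
  have *: "(\<tau> *\<^sub>R v + \<tau>\<^sup>2 *\<^sub>R w) \<bullet> (A *v (\<tau> *\<^sub>R v + \<tau>\<^sup>2 *\<^sub>R w)) =
    \<tau>\<^sup>2 * (v \<bullet> (A *v v)) + 2 * \<tau>^3 * (v \<bullet> (A *v w)) + \<tau>^4 * (w \<bullet> (A *v w))"
    unfolding form_add_scaleR[OF assms]
    by (simp add: matrix_vector_mult_scaleR power2_eq_square power3_eq_cube power4_eq_xxxx)
  show ?thesis
    unfolding quad_fun_add[OF assms] *
    by (simp add: inner_add_right algebra_simps power2_eq_square power3_eq_cube power4_eq_xxxx)
qed

text \<open>
  Along the arc, the increment is a polynomial in \<open>\<tau>\<close> without constant term; its sign for small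
  \<open>\<tau> > 0\<close> is that of its first nonzero coefficient.
\<close>

lemma quad_fun_arc_eventually_less:
  fixes A :: "real ^ 'n ^ 'n"
  assumes "symmetric_matrix A"
    and "(A *v x + b) \<bullet> v < 0 \<or>
      (A *v x + b) \<bullet> v = 0 \<and> 2 * ((A *v x + b) \<bullet> w) + v \<bullet> (A *v v) < 0"
  shows "\<forall>\<^sub>F \<tau> in at_right 0.
    quad_fun A b c (x + (\<tau> *\<^sub>R v + \<tau>\<^sup>2 *\<^sub>R w)) < quad_fun A b c x"
proof -
  define p q r s where "p = 2 * ((A *v x + b) \<bullet> v)"
    and "q = 2 * ((A *v x + b) \<bullet> w) + v \<bullet> (A *v v)"
    and "r = 2 * (v \<bullet> (A *v w))" and "s = w \<bullet> (A *v w)"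
  have pos: "\<forall>\<^sub>F \<tau>::real in at_right 0. \<tau> > 0" by (simp add: eventually_at_right_less)
  have "\<forall>\<^sub>F \<tau> in at_right 0. \<tau> * (p + \<tau> * (q + \<tau> * (r + \<tau> * s))) < 0"
  proof (cases "p < 0")
    case True
    have "((\<lambda>\<tau>. p + \<tau> * (q + \<tau> * (r + \<tau> * s))) \<longlongrightarrow> p + 0 * (q + 0 * (r + 0 * s))) (at_right 0)"
      by (intro tendsto_intros)
    then have "\<forall>\<^sub>F \<tau> in at_right 0. p + \<tau> * (q + \<tau> * (r + \<tau> * s)) < 0"
      using True by (intro order_tendstoD(2)) auto
    with pos show ?thesis by eventually_elim (simp add: mult_pos_neg)
  next
    case False
    with assms(2) have p0: "p = 0" and "q < 0" by (auto simp: p_def q_def)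
    have "((\<lambda>\<tau>. q + \<tau> * (r + \<tau> * s)) \<longlongrightarrow> q + 0 * (r + 0 * s)) (at_right 0)"
      by (intro tendsto_intros)
    then have "\<forall>\<^sub>F \<tau> in at_right 0. q + \<tau> * (r + \<tau> * s) < 0"
      using \<open>q < 0\<close> by (intro order_tendstoD(2)) auto
    with pos show ?thesis by eventually_elim (simp add: p0 mult_pos_neg)
  qed
  then show ?thesis
    using quad_fun_arc[OF assms(1), of b c x _ v w]
    unfolding p_def q_def r_def s_def by (smt (verit) eventually_mono)
qed

lemma local_minimizer_no_descent_arc:
  fixes x v w :: "'a::real_normed_vector"
  assumes "local_minimizer f S x"
    and "\<forall>\<^sub>F \<tau> in at_right 0. x + (\<tau> *\<^sub>R v + \<tau>\<^sup>2 *\<^sub>R w) \<in> S"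
    and "\<forall>\<^sub>F \<tau> in at_right 0. f (x + (\<tau> *\<^sub>R v + \<tau>\<^sup>2 *\<^sub>R w)) < f x"
  shows False
proof -
  obtain \<epsilon> where "\<epsilon> > 0" and min: "\<And>y. y \<in> S \<Longrightarrow> dist y x < \<epsilon> \<Longrightarrow> f x \<le> f y"
    using assms(1) unfolding local_minimizer_def by (auto simp: dist_commute)
  have "((\<lambda>\<tau>. norm (\<tau> *\<^sub>R v + \<tau>\<^sup>2 *\<^sub>R w)) \<longlongrightarrow> norm (0 *\<^sub>R v + 0\<^sup>2 *\<^sub>R w)) (at_right 0)"
    by (intro tendsto_intros)
  then have "\<forall>\<^sub>F \<tau> in at_right 0. norm (\<tau> *\<^sub>R v + \<tau>\<^sup>2 *\<^sub>R w) < \<epsilon>"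
    using \<open>\<epsilon> > 0\<close> by (intro order_tendstoD(2)) auto
  with assms(2,3) have "\<forall>\<^sub>F \<tau>::real in at_right 0. False"
  proof eventually_elim
    case (elim \<tau>)
    then show ?case using min[of "x + (\<tau> *\<^sub>R v + \<tau>\<^sup>2 *\<^sub>R w)"] by (simp add: dist_norm)
  qed
  then show False by simp
qed

text \<open>
  A Lagrangian with nonnegative Hessian is convex, so a stationary point minimizes it over the whole
  space; on the feasible set it is a lower bound of the objective, and it is exact at \<open>x\<close> by
  complementary slackness.
\<close>

lemma global_minimizer_if_lagrangian_psd:
  fixes A\<^sub>0 A\<^sub>1 :: "real ^ 'n ^ 'n"
  assumes "symmetric_matrix A\<^sub>0" "symmetric_matrix A\<^sub>1"
    and "quad_fun A\<^sub>1 b\<^sub>1 c\<^sub>1 x \<le> 0" "\<alpha> \<ge> 0" "\<alpha> * quad_fun A\<^sub>1 b\<^sub>1 c\<^sub>1 x = 0"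
    and stat: "(A\<^sub>0 *v x + b\<^sub>0) + \<alpha> *\<^sub>R (A\<^sub>1 *v x + b\<^sub>1) = 0"
    and psd: "\<And>v. v \<bullet> ((A\<^sub>0 + \<alpha> *\<^sub>R A\<^sub>1) *v v) \<ge> 0"
  shows "global_minimizer (quad_fun A\<^sub>0 b\<^sub>0 c\<^sub>0) {x. quad_fun A\<^sub>1 b\<^sub>1 c\<^sub>1 x \<le> 0} x"
  unfolding global_minimizer_def
proof (intro conjI ballI)
  fix y assume "y \<in> {x. quad_fun A\<^sub>1 b\<^sub>1 c\<^sub>1 x \<le> 0}"
  then have "\<alpha> * quad_fun A\<^sub>1 b\<^sub>1 c\<^sub>1 y \<le> 0" using \<open>\<alpha> \<ge> 0\<close> by (simp add: mult_nonneg_nonpos)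
  define d where "d = y - x"
  have y: "y = x + d" by (simp add: d_def)
  have "((A\<^sub>0 *v x + b\<^sub>0) + \<alpha> *\<^sub>R (A\<^sub>1 *v x + b\<^sub>1)) \<bullet> d = 0" using stat by simp
  then have lin: "(A\<^sub>0 *v x + b\<^sub>0) \<bullet> d + \<alpha> * ((A\<^sub>1 *v x + b\<^sub>1) \<bullet> d) = 0"
    by (metis inner_add_left inner_scaleR_left)
  have "quad_fun A\<^sub>0 b\<^sub>0 c\<^sub>0 y + \<alpha> * quad_fun A\<^sub>1 b\<^sub>1 c\<^sub>1 y
      = quad_fun A\<^sub>0 b\<^sub>0 c\<^sub>0 x + \<alpha> * quad_fun A\<^sub>1 b\<^sub>1 c\<^sub>1 x
        + 2 * ((A\<^sub>0 *v x + b\<^sub>0) \<bullet> d + \<alpha> * ((A\<^sub>1 *v x + b\<^sub>1) \<bullet> d))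
        + d \<bullet> ((A\<^sub>0 + \<alpha> *\<^sub>R A\<^sub>1) *v d)"
    unfolding y quad_fun_add[OF assms(1)] quad_fun_add[OF assms(2)] pencil_mult_vec inner_add_right
    by (simp add: algebra_simps)
  then show "quad_fun A\<^sub>0 b\<^sub>0 c\<^sub>0 x \<le> quad_fun A\<^sub>0 b\<^sub>0 c\<^sub>0 y"
    using lin psd[of d] assms(5) \<open>\<alpha> * quad_fun A\<^sub>1 b\<^sub>1 c\<^sub>1 y \<le> 0\<close> by simp
qed (use assms(3) in simp)

text \<open>
  What the uniqueness argument uses of a local-nonglobal minimizer with multiplier \<open>\<alpha>\<close>. The first
  three conjuncts come from local minimality; the last one is the trace left by failing to be
  a global minimizer.
\<close>

definition saddle_critical ::
  "real ^ 'n ^ 'n \<Rightarrow> real ^ 'n \<Rightarrow> real ^ 'n ^ 'n \<Rightarrow> real ^ 'n \<Rightarrow> real \<Rightarrow> real \<Rightarrow> real ^ 'n \<Rightarrow> bool" where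
  "saddle_critical A\<^sub>0 b\<^sub>0 A\<^sub>1 b\<^sub>1 c\<^sub>1 \<alpha> x \<longleftrightarrow>
    quad_fun A\<^sub>1 b\<^sub>1 c\<^sub>1 x = 0 \<and>
    (A\<^sub>0 *v x + b\<^sub>0) + \<alpha> *\<^sub>R (A\<^sub>1 *v x + b\<^sub>1) = 0 \<and>
    (\<forall>v. (A\<^sub>1 *v x + b\<^sub>1) \<bullet> v = 0 \<longrightarrow> v \<bullet> ((A\<^sub>0 + \<alpha> *\<^sub>R A\<^sub>1) *v v) \<ge> 0) \<and>
    (\<exists>u. u \<bullet> ((A\<^sub>0 + \<alpha> *\<^sub>R A\<^sub>1) *v u) < 0)"

text \<open>
  In the interior all directions are feasible, so \<open>x\<close> is an unconstrained local minimizer of \<open>f\<^sub>0\<close>;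
  for a quadratic function such a point is already a global one.
\<close>

lemma local_nonglobal_minimizer_boundary:
  fixes A\<^sub>0 A\<^sub>1 :: "real ^ 'n ^ 'n"
  assumes sym: "symmetric_matrix A\<^sub>0" "symmetric_matrix A\<^sub>1"
    and lng: "local_nonglobal_minimizer (quad_fun A\<^sub>0 b\<^sub>0 c\<^sub>0) {x. quad_fun A\<^sub>1 b\<^sub>1 c\<^sub>1 x \<le> 0} x"
  shows "quad_fun A\<^sub>1 b\<^sub>1 c\<^sub>1 x = 0"
proof (rule ccontr)
  let ?S = "{x. quad_fun A\<^sub>1 b\<^sub>1 c\<^sub>1 x \<le> 0}"
  let ?f = "quad_fun A\<^sub>0 b\<^sub>0 c\<^sub>0"
  define g0 where "g0 = A\<^sub>0 *v x + b\<^sub>0"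
  have loc: "local_minimizer ?f ?S x" and ng: "\<not> global_minimizer ?f ?S x"
    using lng by (auto simp: local_nonglobal_minimizer_def)
  assume "quad_fun A\<^sub>1 b\<^sub>1 c\<^sub>1 x \<noteq> 0"
  then have neg: "quad_fun A\<^sub>1 b\<^sub>1 c\<^sub>1 x < 0" using loc by (auto simp: local_minimizer_def)
  have feasible: "\<forall>\<^sub>F \<tau> in at_right 0. x + (\<tau> *\<^sub>R v + \<tau>\<^sup>2 *\<^sub>R 0) \<in> ?S" for v
  proof -
    have "((\<lambda>\<tau>. quad_fun A\<^sub>1 b\<^sub>1 c\<^sub>1 (x + (\<tau> *\<^sub>R v + \<tau>\<^sup>2 *\<^sub>R 0))) \<longlongrightarrow>
        quad_fun A\<^sub>1 b\<^sub>1 c\<^sub>1 (x + (0 *\<^sub>R v + 0\<^sup>2 *\<^sub>R 0))) (at_right 0)"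
      unfolding quad_fun_add[OF sym(2)] matrix_vector_right_distrib matrix_vector_mult_scaleR
      by (intro tendsto_intros)
    then have "\<forall>\<^sub>F \<tau> in at_right 0. quad_fun A\<^sub>1 b\<^sub>1 c\<^sub>1 (x + (\<tau> *\<^sub>R v + \<tau>\<^sup>2 *\<^sub>R 0)) < 0"
      using neg by (intro order_tendstoD(2)) auto
    then show ?thesis by eventually_elim simp
  qed
  have no_descent: "\<not> (g0 \<bullet> v < 0 \<or> g0 \<bullet> v = 0 \<and> v \<bullet> (A\<^sub>0 *v v) < 0)" for v
    using local_minimizer_no_descent_arc[OF loc feasible, of v]
      quad_fun_arc_eventually_less[OF sym(1), of x b\<^sub>0 v 0 c\<^sub>0] by (auto simp: g0_def)
  have "g0 = 0" using no_descent[of "- g0"] by simp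
  with no_descent have "v \<bullet> (A\<^sub>0 *v v) \<ge> 0" for v by (simp add: not_less)
  then have "global_minimizer ?f ?S x"
    using neg \<open>g0 = 0\<close> sym
    by (intro global_minimizer_if_lagrangian_psd[where \<alpha> = 0]) (auto simp: g0_def)
  with ng show False ..
qed

text \<open>
  If the constraint gradient vanishes at the boundary point \<open>x\<close>, the feasible set is the cone
  \<open>v \<bullet> (A\<^sub>1 *v v) \<le> 0\<close> with apex \<open>x\<close>. It contains the whole line through \<open>x\<close> and any other of its points,
  and on each such line local minimality at \<open>x\<close> of a quadratic function is global minimality.
\<close>

lemma local_nonglobal_minimizer_regular:
  fixes A\<^sub>0 A\<^sub>1 :: "real ^ 'n ^ 'n"
  assumes sym: "symmetric_matrix A\<^sub>0" "symmetric_matrix A\<^sub>1"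
    and lng: "local_nonglobal_minimizer (quad_fun A\<^sub>0 b\<^sub>0 c\<^sub>0) {x. quad_fun A\<^sub>1 b\<^sub>1 c\<^sub>1 x \<le> 0} x"
  shows "A\<^sub>1 *v x + b\<^sub>1 \<noteq> 0"
proof
  let ?S = "{x. quad_fun A\<^sub>1 b\<^sub>1 c\<^sub>1 x \<le> 0}"
  let ?f = "quad_fun A\<^sub>0 b\<^sub>0 c\<^sub>0"
  define g0 where "g0 = A\<^sub>0 *v x + b\<^sub>0"
  have loc: "local_minimizer ?f ?S x" and ng: "\<not> global_minimizer ?f ?S x"
    using lng by (auto simp: local_nonglobal_minimizer_def)
  note boundary = local_nonglobal_minimizer_boundary[OF sym lng]
  assume g: "A\<^sub>1 *v x + b\<^sub>1 = 0"
  have f1: "quad_fun A\<^sub>1 b\<^sub>1 c\<^sub>1 (x + v) = v \<bullet> (A\<^sub>1 *v v)" for v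
    using quad_fun_add[OF sym(2), of b\<^sub>1 c\<^sub>1 x v] boundary g by simp
  have no_descent: "\<not> (g0 \<bullet> v < 0 \<or> g0 \<bullet> v = 0 \<and> v \<bullet> (A\<^sub>0 *v v) < 0)"
    if "v \<bullet> (A\<^sub>1 *v v) \<le> 0" for v
  proof -
    have "x + (\<tau> *\<^sub>R v + \<tau>\<^sup>2 *\<^sub>R 0) \<in> ?S" for \<tau>
      using mult_nonneg_nonpos[OF zero_le_power2 that, of \<tau>]
      by (simp add: f1 matrix_vector_mult_scaleR power2_eq_square mult.assoc)
    then have "\<forall>\<^sub>F \<tau> in at_right 0. x + (\<tau> *\<^sub>R v + \<tau>\<^sup>2 *\<^sub>R 0) \<in> ?S" by simp
    from local_minimizer_no_descent_arc[OF loc this] show ?thesis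
      using quad_fun_arc_eventually_less[OF sym(1), of x b\<^sub>0 v 0 c\<^sub>0] by (auto simp: g0_def)
  qed
  have "?f x \<le> ?f y" if "y \<in> ?S" for y
  proof -
    define v where "v = y - x"
    have y: "y = x + v" by (simp add: v_def)
    have v: "v \<bullet> (A\<^sub>1 *v v) \<le> 0" using that unfolding y by (simp add: f1)
    then have "(- v) \<bullet> (A\<^sub>1 *v (- v)) \<le> 0"
      by (simp add: matrix_vector_mult_scaleR[where c = "-1", simplified])
    from no_descent[OF v] no_descent[OF this] show ?thesis
      unfolding y quad_fun_add[OF sym(1)] g0_def[symmetric] by auto
  qed
  then have "global_minimizer ?f ?S x" using boundary by (auto simp: global_minimizer_def)
  with ng show False ..
qed

text \<open>
  Since the constraint is regular, a violated first- or second-order condition yields an arc that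
  enters the interior of the feasible set while the objective decreases. The multiplier is the one
  that makes the Lagrangian's gradient orthogonal to the constraint gradient \<open>g\<close>.
\<close>

lemma local_nonglobal_minimizer_saddle_critical:
  fixes A\<^sub>0 A\<^sub>1 :: "real ^ 'n ^ 'n"
  assumes sym: "symmetric_matrix A\<^sub>0" "symmetric_matrix A\<^sub>1"
    and lng: "local_nonglobal_minimizer (quad_fun A\<^sub>0 b\<^sub>0 c\<^sub>0) {x. quad_fun A\<^sub>1 b\<^sub>1 c\<^sub>1 x \<le> 0} x"
  shows "\<exists>\<alpha>. saddle_critical A\<^sub>0 b\<^sub>0 A\<^sub>1 b\<^sub>1 c\<^sub>1 \<alpha> x"
proof -
  let ?S = "{x. quad_fun A\<^sub>1 b\<^sub>1 c\<^sub>1 x \<le> 0}"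
  let ?f = "quad_fun A\<^sub>0 b\<^sub>0 c\<^sub>0"
  have loc: "local_minimizer ?f ?S x" and ng: "\<not> global_minimizer ?f ?S x"
    using lng by (auto simp: local_nonglobal_minimizer_def)
  note boundary = local_nonglobal_minimizer_boundary[OF sym lng]
  define g0 where "g0 = A\<^sub>0 *v x + b\<^sub>0"
  define g where "g = A\<^sub>1 *v x + b\<^sub>1"
  have "g \<noteq> 0" using local_nonglobal_minimizer_regular[OF sym lng] by (simp add: g_def)
  then have gg: "g \<bullet> g > 0" by simp
  have no_descent: False
    if "g \<bullet> v < 0 \<or> g \<bullet> v = 0 \<and> 2 * (g \<bullet> w) + v \<bullet> (A\<^sub>1 *v v) < 0"
      and "g0 \<bullet> v < 0 \<or> g0 \<bullet> v = 0 \<and> 2 * (g0 \<bullet> w) + v \<bullet> (A\<^sub>0 *v v) < 0" for v w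
  proof (rule local_minimizer_no_descent_arc[OF loc])
    have "\<forall>\<^sub>F \<tau> in at_right 0. quad_fun A\<^sub>1 b\<^sub>1 c\<^sub>1 (x + (\<tau> *\<^sub>R v + \<tau>\<^sup>2 *\<^sub>R w)) < quad_fun A\<^sub>1 b\<^sub>1 c\<^sub>1 x"
      using quad_fun_arc_eventually_less[OF sym(2)] that(1) unfolding g_def .
    then show "\<forall>\<^sub>F \<tau> in at_right 0. x + (\<tau> *\<^sub>R v + \<tau>\<^sup>2 *\<^sub>R w) \<in> ?S"
      by eventually_elim (simp add: boundary)
    show "\<forall>\<^sub>F \<tau> in at_right 0. ?f (x + (\<tau> *\<^sub>R v + \<tau>\<^sup>2 *\<^sub>R w)) < ?f x"
      using quad_fun_arc_eventually_less[OF sym(1)] that(2) unfolding g0_def .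
  qed
  define \<alpha> where "\<alpha> = - (g0 \<bullet> g) / (g \<bullet> g)"
  have g0g: "g0 \<bullet> g = - \<alpha> * (g \<bullet> g)" using gg by (simp add: \<alpha>_def)
  have "\<alpha> \<ge> 0"
  proof (rule ccontr)
    assume "\<not> \<alpha> \<ge> 0"
    then have "g0 \<bullet> g > 0" using gg unfolding g0g by (simp add: mult_neg_pos)
    then show False using no_descent[of "- g" 0] gg by simp
  qed
  define r where "r = g0 + \<alpha> *\<^sub>R g"
  have gr: "g \<bullet> r = 0" using g0g by (simp add: r_def inner_add_right inner_commute)
  have g0r: "g0 \<bullet> r = r \<bullet> r" using gr by (simp add: r_def inner_add_left inner_commute)
  have "r = 0"
  proof (rule ccontr)
    assume "r \<noteq> 0"
    then have rr: "r \<bullet> r > 0" by simp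
    \<comment> \<open>The direction \<open>- r\<close> is tangent and decreases the objective. Tilting it inward by \<open>\<epsilon>\<close> costs
      \<open>\<epsilon> * \<alpha> * (g \<bullet> g)\<close>, which this \<open>\<epsilon>\<close> keeps below the gain \<open>r \<bullet> r\<close>.\<close>
    define \<epsilon> where "\<epsilon> = (r \<bullet> r) / ((\<alpha> + 1) * (g \<bullet> g))"
    have "\<epsilon> > 0" using rr gg \<open>\<alpha> \<ge> 0\<close> by (simp add: \<epsilon>_def)
    have "\<epsilon> * ((\<alpha> + 1) * (g \<bullet> g)) = r \<bullet> r"
      using gg \<open>\<alpha> \<ge> 0\<close> by (simp add: \<epsilon>_def)
    then have "\<epsilon> * (\<alpha> * (g \<bullet> g)) + \<epsilon> * (g \<bullet> g) = r \<bullet> r"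
      by (simp add: algebra_simps)
    moreover have "\<epsilon> * (g \<bullet> g) > 0" using \<open>\<epsilon> > 0\<close> gg by simp
    ultimately have "g0 \<bullet> (- r - \<epsilon> *\<^sub>R g) < 0"
      using g0g g0r by (simp add: inner_diff_right)
    moreover have "g \<bullet> (- r - \<epsilon> *\<^sub>R g) < 0"
      using gr \<open>\<epsilon> * (g \<bullet> g) > 0\<close> by (simp add: inner_diff_right)
    ultimately show False using no_descent[of "- r - \<epsilon> *\<^sub>R g" 0] by blast
  qed
  then have g0: "g0 = - (\<alpha> *\<^sub>R g)" by (simp add: r_def eq_neg_iff_add_eq_0)
  have second: "v \<bullet> ((A\<^sub>0 + \<alpha> *\<^sub>R A\<^sub>1) *v v) \<ge> 0" if gv: "g \<bullet> v = 0" for v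
  proof (rule ccontr)
    define h where "h = v \<bullet> ((A\<^sub>0 + \<alpha> *\<^sub>R A\<^sub>1) *v v)"
    define a where "a = v \<bullet> (A\<^sub>1 *v v)"
    assume "\<not> v \<bullet> ((A\<^sub>0 + \<alpha> *\<^sub>R A\<^sub>1) *v v) \<ge> 0"
    then have "h < 0" by (simp add: h_def)
    have h: "v \<bullet> (A\<^sub>0 *v v) = h - \<alpha> * a"
      by (simp add: h_def a_def pencil_mult_vec inner_add_right)
    \<comment> \<open>The arc's curvature \<open>w\<close> is chosen so that the second-order coefficient of the constraint is
      \<open>- \<epsilon>\<close>; that of the objective is then \<open>h + \<alpha> * \<epsilon>\<close>, which equals \<open>- \<epsilon>\<close> for this \<open>\<epsilon>\<close>.\<close>
    define \<epsilon> where "\<epsilon> = - h / (\<alpha> + 1)"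
    have "\<epsilon> > 0" using \<open>h < 0\<close> \<open>\<alpha> \<ge> 0\<close> by (simp add: \<epsilon>_def divide_neg_pos)
    have "\<epsilon> * (\<alpha> + 1) = - h" using \<open>\<alpha> \<ge> 0\<close> by (simp add: \<epsilon>_def)
    then have le: "\<alpha> * \<epsilon> + \<epsilon> = - h" by (simp add: algebra_simps)
    define w where "w = (- (a + \<epsilon>) / (2 * (g \<bullet> g))) *\<^sub>R g"
    have gw: "2 * (g \<bullet> w) = - (a + \<epsilon>)" using gg by (simp add: w_def field_simps)
    have "2 * (g0 \<bullet> w) = - \<alpha> * (2 * (g \<bullet> w))" by (simp add: g0)
    then have "2 * (g0 \<bullet> w) + v \<bullet> (A\<^sub>0 *v v) < 0"
      unfolding gw h using le \<open>\<epsilon> > 0\<close> by (simp add: algebra_simps)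
    moreover have "2 * (g \<bullet> w) + v \<bullet> (A\<^sub>1 *v v) < 0"
      unfolding gw a_def[symmetric] using \<open>\<epsilon> > 0\<close> by simp
    moreover have "g0 \<bullet> v = 0" using gv by (simp add: g0)
    ultimately show False using no_descent[of v w] gv by blast
  qed
  have stat: "(A\<^sub>0 *v x + b\<^sub>0) + \<alpha> *\<^sub>R (A\<^sub>1 *v x + b\<^sub>1) = 0"
    using \<open>r = 0\<close> by (simp add: r_def g0_def g_def)
  have "\<exists>u. u \<bullet> ((A\<^sub>0 + \<alpha> *\<^sub>R A\<^sub>1) *v u) < 0"
  proof (rule ccontr)
    assume "\<not> ?thesis"
    then have "global_minimizer ?f ?S x"
      using boundary \<open>\<alpha> \<ge> 0\<close> stat sym
      by (intro global_minimizer_if_lagrangian_psd[where \<alpha> = \<alpha>]) (auto simp: not_less)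
    with ng show False ..
  qed
  then show ?thesis
    using boundary stat second unfolding saddle_critical_def g_def by blast
qed

section \<open>Uniqueness under joint negative definiteness\<close>

lemma saddle_critical_pair:
  fixes A\<^sub>0 A\<^sub>1 :: "real ^ 'n ^ 'n"
  assumes sym: "symmetric_matrix A\<^sub>0" "symmetric_matrix A\<^sub>1"
    and x: "saddle_critical A\<^sub>0 b\<^sub>0 A\<^sub>1 b\<^sub>1 c\<^sub>1 \<alpha> x"
    and y: "saddle_critical A\<^sub>0 b\<^sub>0 A\<^sub>1 b\<^sub>1 c\<^sub>1 \<beta> y"
  shows "(A\<^sub>0 + \<alpha> *\<^sub>R A\<^sub>1) *v (y - x) = (\<alpha> - \<beta>) *\<^sub>R (A\<^sub>1 *v y + b\<^sub>1)"
    and "(y - x) \<bullet> ((A\<^sub>0 + \<alpha> *\<^sub>R A\<^sub>1) *v (y - x)) = quad_fun A\<^sub>0 b\<^sub>0 c\<^sub>0 y - quad_fun A\<^sub>0 b\<^sub>0 c\<^sub>0 x"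
    and "(y - x) \<bullet> (A\<^sub>1 *v (y - x)) = - 2 * ((A\<^sub>1 *v x + b\<^sub>1) \<bullet> (y - x))"
proof -
  define d where "d = y - x"
  define g0 where "g0 = A\<^sub>0 *v x + b\<^sub>0"
  define g where "g = A\<^sub>1 *v x + b\<^sub>1"
  have yd: "y = x + d" by (simp add: d_def)
  have sx: "(A\<^sub>0 *v x + b\<^sub>0) + \<alpha> *\<^sub>R (A\<^sub>1 *v x + b\<^sub>1) = 0"
    and sy: "(A\<^sub>0 *v y + b\<^sub>0) + \<beta> *\<^sub>R (A\<^sub>1 *v y + b\<^sub>1) = 0"
    and bx: "quad_fun A\<^sub>1 b\<^sub>1 c\<^sub>1 x = 0" and b_y: "quad_fun A\<^sub>1 b\<^sub>1 c\<^sub>1 y = 0"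
    using x y by (auto simp: saddle_critical_def)
  have "(A\<^sub>0 + \<alpha> *\<^sub>R A\<^sub>1) *v (y - x) =
      ((A\<^sub>0 *v y + b\<^sub>0) + \<alpha> *\<^sub>R (A\<^sub>1 *v y + b\<^sub>1)) - ((A\<^sub>0 *v x + b\<^sub>0) + \<alpha> *\<^sub>R (A\<^sub>1 *v x + b\<^sub>1))"
    unfolding pencil_mult_vec matrix_vector_mult_diff_distrib by (simp add: algebra_simps)
  also have "\<dots> = ((A\<^sub>0 *v y + b\<^sub>0) + \<beta> *\<^sub>R (A\<^sub>1 *v y + b\<^sub>1)) + (\<alpha> - \<beta>) *\<^sub>R (A\<^sub>1 *v y + b\<^sub>1)"
    unfolding sx by (simp add: algebra_simps)
  finally show "(A\<^sub>0 + \<alpha> *\<^sub>R A\<^sub>1) *v (y - x) = (\<alpha> - \<beta>) *\<^sub>R (A\<^sub>1 *v y + b\<^sub>1)"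
    unfolding sy by simp
  have a: "d \<bullet> (A\<^sub>1 *v d) = - 2 * (g \<bullet> d)"
    using quad_fun_add[OF sym(2), of b\<^sub>1 c\<^sub>1 x d] bx b_y unfolding yd g_def by simp
  then show "(y - x) \<bullet> (A\<^sub>1 *v (y - x)) = - 2 * ((A\<^sub>1 *v x + b\<^sub>1) \<bullet> (y - x))"
    by (simp add: d_def g_def)
  have "(g0 + \<alpha> *\<^sub>R g) \<bullet> d = 0" using sx by (simp add: g0_def g_def)
  then have "g0 \<bullet> d + \<alpha> * (g \<bullet> d) = 0" by (simp add: inner_add_left)
  moreover have "quad_fun A\<^sub>0 b\<^sub>0 c\<^sub>0 y - quad_fun A\<^sub>0 b\<^sub>0 c\<^sub>0 x = 2 * (g0 \<bullet> d) + d \<bullet> (A\<^sub>0 *v d)"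
    unfolding yd quad_fun_add[OF sym(1)] g0_def by simp
  moreover have "d \<bullet> ((A\<^sub>0 + \<alpha> *\<^sub>R A\<^sub>1) *v d) = d \<bullet> (A\<^sub>0 *v d) + \<alpha> * (d \<bullet> (A\<^sub>1 *v d))"
    by (simp add: pencil_mult_vec inner_add_right)
  ultimately show "(y - x) \<bullet> ((A\<^sub>0 + \<alpha> *\<^sub>R A\<^sub>1) *v (y - x))
      = quad_fun A\<^sub>0 b\<^sub>0 c\<^sub>0 y - quad_fun A\<^sub>0 b\<^sub>0 c\<^sub>0 x"
    unfolding d_def[symmetric] a by (simp add: algebra_simps)
qed

text \<open>
  At equal objective values both Hessians vanish at \<open>d = y - x\<close>. Only one member of the pencil can do
  so, since \<open>d \<bullet> (A\<^sub>1 *v d) = 0\<close> would make every member vanish at \<open>d\<close>, including the negative definite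
  one. The multipliers therefore agree, \<open>d\<close> is in the kernel of the common Hessian, and this Hessian is
  determined by its values on the tangent hyperplane, where it is nonnegative.
\<close>

lemma saddle_critical_equal_value_unique:
  fixes A\<^sub>0 A\<^sub>1 :: "real ^ 'n ^ 'n"
  assumes sym: "symmetric_matrix A\<^sub>0" "symmetric_matrix A\<^sub>1"
    and nd: "negative_definite (A\<^sub>0 + \<nu> *\<^sub>R A\<^sub>1)"
    and x: "saddle_critical A\<^sub>0 b\<^sub>0 A\<^sub>1 b\<^sub>1 c\<^sub>1 \<alpha> x"
    and y: "saddle_critical A\<^sub>0 b\<^sub>0 A\<^sub>1 b\<^sub>1 c\<^sub>1 \<beta> y"
    and eq: "quad_fun A\<^sub>0 b\<^sub>0 c\<^sub>0 x = quad_fun A\<^sub>0 b\<^sub>0 c\<^sub>0 y"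
  shows "x = y"
proof (rule ccontr)
  define d where "d = y - x"
  define g where "g = A\<^sub>1 *v x + b\<^sub>1"
  let ?P = "\<lambda>c. A\<^sub>0 + c *\<^sub>R A\<^sub>1"
  assume "x \<noteq> y"
  then have "d \<noteq> 0" by (simp add: d_def)
  then have neg: "d \<bullet> (?P \<nu> *v d) < 0" using nd by (simp add: negative_definite_def)
  have form: "d \<bullet> (?P c *v d) = d \<bullet> (A\<^sub>0 *v d) + c * (d \<bullet> (A\<^sub>1 *v d))" for c
    by (simp add: pencil_mult_vec inner_add_right)
  have dx: "d \<bullet> (?P \<alpha> *v d) = 0"
    using saddle_critical_pair(2)[OF sym x y, of c\<^sub>0] eq by (simp add: d_def)
  have "(x - y) \<bullet> (?P \<beta> *v (x - y)) = 0"
    using saddle_critical_pair(2)[OF sym y x, of c\<^sub>0] eq by simp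
  then have dy: "d \<bullet> (?P \<beta> *v d) = 0"
    by (simp add: d_def matrix_vector_mult_diff_distrib inner_diff_left inner_diff_right)
  have a0: "d \<bullet> (A\<^sub>1 *v d) \<noteq> 0" using neg dx unfolding form by auto
  have "\<alpha> = \<beta>" using dx dy a0 unfolding form by (metis add_left_cancel mult_right_cancel)
  then have Pd: "?P \<alpha> *v d = 0" using saddle_critical_pair(1)[OF sym x y] by (simp add: d_def)
  have gd: "g \<bullet> d \<noteq> 0"
    using saddle_critical_pair(3)[OF sym x y] a0 by (simp add: d_def g_def)
  obtain u where u: "u \<bullet> (?P \<alpha> *v u) < 0" using x by (auto simp: saddle_critical_def)
  obtain e k where z: "u = e + k *\<^sub>R d" and e: "g \<bullet> e = 0"
    using hyperplane_decomposition[OF gd] by blast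
  have "u \<bullet> (?P \<alpha> *v u) = e \<bullet> (?P \<alpha> *v e)"
    unfolding z form_add_scaleR[OF symmetric_matrix_pencil[OF sym]] Pd by simp
  moreover have "e \<bullet> (?P \<alpha> *v e) \<ge> 0" using x e by (auto simp: saddle_critical_def g_def)
  ultimately show False using u by simp
qed

text \<open>
  Suppose the inequality holds. The tangent hyperplane at \<open>y\<close> is the complement of
  \<open>d = y - x\<close> with respect to the Hessian at \<open>x\<close>, and so inherits from that Hessian a negative
  direction \<open>v\<close>; likewise \<open>d\<close> and the tangent hyperplane at \<open>x\<close> are complementary with respect to the
  Hessian at \<open>y\<close>. The signs of the two Hessians on these pieces are incompatible with joint negative
  definiteness.
\<close>

lemma saddle_critical_not_less:
  fixes A\<^sub>0 A\<^sub>1 :: "real ^ 'n ^ 'n"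
  assumes sym: "symmetric_matrix A\<^sub>0" "symmetric_matrix A\<^sub>1"
    and nd: "negative_definite (A\<^sub>0 + \<nu> *\<^sub>R A\<^sub>1)"
    and x: "saddle_critical A\<^sub>0 b\<^sub>0 A\<^sub>1 b\<^sub>1 c\<^sub>1 \<alpha> x"
    and y: "saddle_critical A\<^sub>0 b\<^sub>0 A\<^sub>1 b\<^sub>1 c\<^sub>1 \<beta> y"
  shows "\<not> quad_fun A\<^sub>0 b\<^sub>0 c\<^sub>0 x < quad_fun A\<^sub>0 b\<^sub>0 c\<^sub>0 y"
proof
  assume less: "quad_fun A\<^sub>0 b\<^sub>0 c\<^sub>0 x < quad_fun A\<^sub>0 b\<^sub>0 c\<^sub>0 y"
  let ?P = "\<lambda>c. A\<^sub>0 + c *\<^sub>R A\<^sub>1"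
  define d where "d = y - x"
  define gx where "gx = A\<^sub>1 *v x + b\<^sub>1"
  define gy where "gy = A\<^sub>1 *v y + b\<^sub>1"
  define a where "a z = z \<bullet> (A\<^sub>1 *v z)" for z
  define D where "D z = - (z \<bullet> (?P \<nu> *v z))" for z
  define s where "s = \<alpha> - \<nu>"
  define t where "t = \<beta> - \<nu>"
  note symP = symmetric_matrix_pencil[OF sym]
  have D_pos: "D z > 0" if "z \<noteq> 0" for z
    using nd that by (simp add: D_def negative_definite_def)
  then have D_nonneg: "D z \<ge> 0" for z
    by (cases "z = 0") (auto simp: D_def intro: less_imp_le)
  have P\<alpha>: "z \<bullet> (?P \<alpha> *v z) = s * a z - D z" and P\<beta>: "z \<bullet> (?P \<beta> *v z) = t * a z - D z" for z
    unfolding D_def a_def s_def t_def pencil_mult_vec inner_add_right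
    by (simp_all add: algebra_simps)
  have P\<alpha>d: "?P \<alpha> *v d = (\<alpha> - \<beta>) *\<^sub>R gy"
    using saddle_critical_pair(1)[OF sym x y] by (simp add: d_def gy_def)
  have neg_d: "?P \<beta> *v d = - (?P \<beta> *v (x - y))"
    by (simp add: d_def matrix_vector_mult_diff_distrib)
  have P\<beta>d: "?P \<beta> *v d = (\<alpha> - \<beta>) *\<^sub>R gx"
    using saddle_critical_pair(1)[OF sym y x] unfolding neg_d gx_def
    by (simp add: scaleR_diff_left)
  have d\<alpha>: "s * a d - D d > 0"
    using saddle_critical_pair(2)[OF sym x y, of c\<^sub>0] less P\<alpha>[of d] by (simp add: d_def)
  have "d \<bullet> (?P \<beta> *v d) = (x - y) \<bullet> (?P \<beta> *v (x - y))"
    unfolding neg_d by (simp add: d_def inner_diff_left)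
  then have d\<beta>: "t * a d - D d < 0"
    using saddle_critical_pair(2)[OF sym y x, of c\<^sub>0] less P\<beta>[of d] by simp
  obtain u where u: "u \<bullet> (?P \<alpha> *v u) < 0" using x by (auto simp: saddle_critical_def)
  define q where "q = d \<bullet> (?P \<alpha> *v d)"
  have "q > 0" using d\<alpha> by (simp add: q_def P\<alpha>)
  \<comment> \<open>The component of \<open>u\<close> along \<open>d\<close> is removed, in the sense of the form \<open>?P \<alpha>\<close>; as the form is
    positive at \<open>d\<close>, this only makes its value smaller.\<close>
  define k where "k = - (u \<bullet> (?P \<alpha> *v d)) / q"
  define v where "v = u + k *\<^sub>R d"
  have kq: "k * q = - (u \<bullet> (?P \<alpha> *v d))" using \<open>q > 0\<close> by (simp add: k_def)
  have uq: "u \<bullet> (?P \<alpha> *v d) = - (k * q)" using kq by simp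
  have "v \<bullet> (?P \<alpha> *v v) = u \<bullet> (?P \<alpha> *v u) - k\<^sup>2 * q"
    unfolding v_def form_add_scaleR[OF symP] q_def[symmetric] uq by (simp add: power2_eq_square)
  moreover have "k\<^sup>2 * q \<ge> 0" using \<open>q > 0\<close> by simp
  ultimately have v\<alpha>: "s * a v - D v < 0" using u unfolding P\<alpha>[of v, symmetric] by linarith
  have "v \<bullet> (?P \<alpha> *v d) = 0"
    unfolding v_def inner_add_left inner_scaleR_left q_def[symmetric] kq by simp
  moreover have "\<alpha> \<noteq> \<beta>" using d\<alpha> d\<beta> by (auto simp: s_def t_def)
  ultimately have "gy \<bullet> v = 0" by (simp add: P\<alpha>d inner_commute)
  then have v\<beta>: "t * a v - D v \<ge> 0"
    using y P\<beta>[of v] by (auto simp: saddle_critical_def gy_def)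
  have "d \<noteq> 0" using less by (auto simp: d_def)
  have "v \<noteq> 0" using v\<alpha> by (auto simp: a_def D_def)
  have "D d > 0" "D v > 0" using D_pos \<open>d \<noteq> 0\<close> \<open>v \<noteq> 0\<close> by auto
  \<comment> \<open>If \<open>s\<close> and \<open>t\<close> had the same sign, so would \<open>a d\<close> and \<open>a v\<close>, and the first two inequalities would
    order \<open>s\<close> and \<open>t\<close> in opposite ways.\<close>
  have "(s - t) * a d > 0" "(t - s) * a v > 0" "s * a d > 0" "t * a v > 0"
    using d\<alpha> d\<beta> v\<alpha> v\<beta> \<open>D d > 0\<close> \<open>D v > 0\<close> by (auto simp: algebra_simps)
  then have "s * t < 0" by (smt (verit) zero_less_mult_iff mult_less_0_iff)
  have "gx \<bullet> d \<noteq> 0"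
  proof
    assume "gx \<bullet> d = 0"
    then have "d \<bullet> (?P \<beta> *v d) = 0" by (simp add: P\<beta>d inner_commute)
    then show False using d\<beta> P\<beta>[of d] by simp
  qed
  \<comment> \<open>For this splitting the form \<open>?P \<beta>\<close> has no cross term, so it is a sum of two nonpositive terms
    that vanish together only at \<open>0\<close>.\<close>
  then obtain e j where v: "v = e + j *\<^sub>R d" and e: "gx \<bullet> e = 0"
    using hyperplane_decomposition by blast
  have "s * a e \<ge> D e" using x e P\<alpha>[of e] by (auto simp: saddle_critical_def gx_def)
  then have "s * a e \<ge> 0" using D_nonneg[of e] by linarith
  then have "t * a e \<le> 0"
    using \<open>s * t < 0\<close> by (smt (verit) zero_le_mult_iff mult_le_0_iff mult_less_0_iff)
  have "e \<bullet> (?P \<beta> *v d) = 0" using e by (simp add: P\<beta>d inner_commute)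
  then have "t * a v - D v = (t * a e - D e) + j\<^sup>2 * (t * a d - D d)"
    unfolding P\<beta>[symmetric] v form_add_scaleR[OF symP] by simp
  moreover have "t * a e - D e < 0 \<or> e = 0 \<and> j \<noteq> 0"
    using \<open>t * a e \<le> 0\<close> D_pos[of e] v \<open>v \<noteq> 0\<close> by (cases "e = 0") auto
  moreover have "j\<^sup>2 * (t * a d - D d) \<le> 0" "j \<noteq> 0 \<Longrightarrow> j\<^sup>2 * (t * a d - D d) < 0"
    using d\<beta> by (simp_all add: mult_le_0_iff mult_less_0_iff)
  moreover have "t * a e - D e \<le> 0" using \<open>t * a e \<le> 0\<close> D_nonneg[of e] by linarith
  ultimately show False using v\<beta> by linarith
qed

theorem corollary3p24:
  fixes A\<^sub>0 A\<^sub>1 :: "real ^ 'n ^ 'n" and b\<^sub>0 b\<^sub>1 :: "real ^ 'n" and c\<^sub>1 :: real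
  assumes "symmetric_matrix A\<^sub>0" and "symmetric_matrix A\<^sub>1"
    and "\<exists>\<mu>\<^sub>1::real. negative_definite (A\<^sub>0 + \<mu>\<^sub>1 *\<^sub>R A\<^sub>1)"
  shows "\<exists>\<^sub>\<le>\<^sub>1x. local_nonglobal_minimizer (quad_fun A\<^sub>0 b\<^sub>0 0) {x. quad_fun A\<^sub>1 b\<^sub>1 c\<^sub>1 x \<le> 0} x"
proof (rule Uniq_I)
  fix x y
  assume x: "local_nonglobal_minimizer (quad_fun A\<^sub>0 b\<^sub>0 0) {x. quad_fun A\<^sub>1 b\<^sub>1 c\<^sub>1 x \<le> 0} x"
    and y: "local_nonglobal_minimizer (quad_fun A\<^sub>0 b\<^sub>0 0) {x. quad_fun A\<^sub>1 b\<^sub>1 c\<^sub>1 x \<le> 0} y"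
  obtain \<nu> where nd: "negative_definite (A\<^sub>0 + \<nu> *\<^sub>R A\<^sub>1)" using assms(3) by blast
  obtain \<alpha> \<beta> where cx: "saddle_critical A\<^sub>0 b\<^sub>0 A\<^sub>1 b\<^sub>1 c\<^sub>1 \<alpha> x"
    and cy: "saddle_critical A\<^sub>0 b\<^sub>0 A\<^sub>1 b\<^sub>1 c\<^sub>1 \<beta> y"
    using local_nonglobal_minimizer_saddle_critical[OF assms(1,2)] x y by blast
  have "quad_fun A\<^sub>0 b\<^sub>0 0 x = quad_fun A\<^sub>0 b\<^sub>0 0 y"
    using saddle_critical_not_less[OF assms(1,2) nd cx cy, of 0]
      saddle_critical_not_less[OF assms(1,2) nd cy cx, of 0] by linarith
  then show "x = y"
    by (rule saddle_critical_equal_value_unique[OF assms(1,2) nd cx cy])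
qed

end
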